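(* Let $G$ be a simple connected $k$-partially walk-regular graph with diameter $D$, adjacency matrix $A$ and spectrum $\{\theta_0^{m_0},\theta_1^{m_1},\ldots,\theta_d^{m_d}\}$ with $\theta_0>\theta_1>\cdots>\theta_d$, let $k<D$, and let $s_k\in\mathbb R_k[x]$ be a Shannon polynomial of $G$. Then $$\Theta(G^k)\le\operatorname{rank} s_k(A)=\sum_{i:\ s_k(\theta_i)\neq0} m_i.$$
   Context: A graph is $k$-partially walk-regular if for each $\ell\le k$ the number of closed walks of length $\ell$ rooted at a vertex does not depend on the vertex. A Shannon polynomial of $G$ (for $k<D$) is a polynomial of the form $s_k(x)=\gamma\prod_{i\in I}(x-\theta_i)$, with $I\subset\{0,\ldots,d\}$, $|I|=k$, and $\gamma\in\mathbb R$, satisfying $\sum_{i=0}^d m_i s_k(\theta_i)=1$, and such that $\sum_{i\in I}m_i$ is maximum among all such choices of $I$ and $\gamma$. $G^k$ has the vertex set of $G$, two distinct vertices adjacent iff their distance in $G$ is at most $k$. $\Theta(H)=\sup_m\alpha(H^{\boxtimes m})^{1/m}$ is the Shannon capacity ($\alpha$ the independence number, $\boxtimes$ the strong product). *)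

theory Defs
  imports "HOL-Analysis.Analysis" "HOL-Computational_Algebra.Polynomial"
begin

text \<open>
  A graph is given by its adjacency relation on the vertex set \<^term>\<open>UNIV :: 'v::finite set\<close>.
  Independence number and Shannon capacity take an explicit carrier set, because the vertex
  sets of the strong powers live in a type of lists.
\<close>

definition simple_graph :: "('v \<Rightarrow> 'v \<Rightarrow> bool) \<Rightarrow> bool" where
  "simple_graph E \<longleftrightarrow> symp E \<and> irreflp E"

text \<open>A walk of length \<open>l\<close> is listed by its \<open>l + 1\<close> vertices.\<close>

definition walks :: "('v \<Rightarrow> 'v \<Rightarrow> bool) \<Rightarrow> 'v \<Rightarrow> nat \<Rightarrow> 'v \<Rightarrow> 'v list set" where
  "walks E u l v =
     {p. length p = Suc l \<and> hd p = u \<and> last p = v \<and> successively E p}"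

definition graph_connected :: "('v \<Rightarrow> 'v \<Rightarrow> bool) \<Rightarrow> bool" where
  "graph_connected E \<longleftrightarrow> (\<forall>u v. \<exists>l. walks E u l v \<noteq> {})"

text \<open>Distance and diameter are meaningful only for connected graphs.\<close>

definition graph_dist :: "('v \<Rightarrow> 'v \<Rightarrow> bool) \<Rightarrow> 'v \<Rightarrow> 'v \<Rightarrow> nat" where
  "graph_dist E u v = (LEAST l. walks E u l v \<noteq> {})"

definition graph_diameter :: "('v::finite \<Rightarrow> 'v \<Rightarrow> bool) \<Rightarrow> nat" where
  "graph_diameter E = Max {graph_dist E u v | u v. True}"

definition partially_walk_regular :: "nat \<Rightarrow> ('v \<Rightarrow> 'v \<Rightarrow> bool) \<Rightarrow> bool" where
  "partially_walk_regular k E \<longleftrightarrow>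
     (\<forall>l\<le>k. \<forall>u v. card (walks E u l u) = card (walks E v l v))"

definition graph_power :: "('v \<Rightarrow> 'v \<Rightarrow> bool) \<Rightarrow> nat \<Rightarrow> 'v \<Rightarrow> 'v \<Rightarrow> bool" where
  "graph_power E k u v \<longleftrightarrow> u \<noteq> v \<and> graph_dist E u v \<le> k"

definition independent_set :: "'a set \<Rightarrow> ('a \<Rightarrow> 'a \<Rightarrow> bool) \<Rightarrow> 'a set \<Rightarrow> bool" where
  "independent_set V E S \<longleftrightarrow> S \<subseteq> V \<and> (\<forall>x\<in>S. \<forall>y\<in>S. \<not> E x y)"

definition independence_number :: "'a set \<Rightarrow> ('a \<Rightarrow> 'a \<Rightarrow> bool) \<Rightarrow> nat" where
  "independence_number V E = Max {card S | S. independent_set V E S}"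

text \<open>The vertices of the \<open>n\<close>-fold strong product are the \<open>n\<close>-tuples of vertices.\<close>

definition strong_power_verts :: "'a set \<Rightarrow> nat \<Rightarrow> 'a list set" where
  "strong_power_verts V n = {xs. set xs \<subseteq> V \<and> length xs = n}"

definition strong_power_adj :: "('a \<Rightarrow> 'a \<Rightarrow> bool) \<Rightarrow> nat \<Rightarrow> 'a list \<Rightarrow> 'a list \<Rightarrow> bool" where
  "strong_power_adj E n xs ys \<longleftrightarrow>
     xs \<noteq> ys \<and> (\<forall>i<n. xs ! i = ys ! i \<or> E (xs ! i) (ys ! i))"

definition shannon_capacity :: "'a set \<Rightarrow> ('a \<Rightarrow> 'a \<Rightarrow> bool) \<Rightarrow> real" where
  "shannon_capacity V E =
     (SUP n\<in>{1..}. root n (real (independence_number (strong_power_verts V n) (strong_power_adj E n))))"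

text \<open>
  The supremum is a genuine one: the family is bounded above, so the value is not the
  arbitrary one that the real supremum takes on unbounded sets.
\<close>

lemma independence_number_le_card:
  assumes "finite V"
  shows "independence_number V E \<le> card V"
proof -
  let ?C = "{card S | S. independent_set V E S}"
  have le: "c \<le> card V" if "c \<in> ?C" for c
    using that card_mono[OF assms] unfolding independent_set_def by blast
  have "?C \<subseteq> {..card V}" using le by blast
  then have fin: "finite ?C" by (rule finite_subset) simp
  have "independent_set V E {}" by (simp add: independent_set_def)
  then have "?C \<noteq> {}" by blast
  from Max_in[OF fin this] show ?thesis
    unfolding independence_number_def by (rule le)
qed

lemma shannon_capacity_bdd_above:
  assumes "finite V"
  shows "bdd_above ((\<lambda>n. root n (real (independence_number (strong_power_verts V n) (strong_power_adj E n)))) ` {1..})"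
proof (rule bdd_aboveI2)
  fix n :: nat
  assume n: "n \<in> {1..}"
  have "finite (strong_power_verts V n)"
    unfolding strong_power_verts_def by (rule finite_lists_length_eq[OF assms])
  from independence_number_le_card[OF this]
  have "independence_number (strong_power_verts V n) (strong_power_adj E n) \<le> card V ^ n"
    using card_lists_length_eq[OF assms, of n] by (simp add: strong_power_verts_def)
  then have "real (independence_number (strong_power_verts V n) (strong_power_adj E n)) \<le> real (card V) ^ n"
    by (simp only: of_nat_power[symmetric] of_nat_le_iff)
  then have "root n (real (independence_number (strong_power_verts V n) (strong_power_adj E n)))
      \<le> root n (real (card V) ^ n)"
    using n by simp
  also have "\<dots> = real (card V)"
    using n by (simp add: real_root_power_cancel)
  finally show "root n (real (independence_number (strong_power_verts V n) (strong_power_adj E n)))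
      \<le> real (card V)" .
qed

definition adjacency_matrix :: "('v::finite \<Rightarrow> 'v \<Rightarrow> bool) \<Rightarrow> real ^ 'v ^ 'v" where
  "adjacency_matrix E = (\<chi> i j. if E i j then 1 else 0)"

primrec matrix_power :: "real ^ 'n ^ 'n \<Rightarrow> nat \<Rightarrow> real ^ 'n::finite ^ 'n" where
  "matrix_power A 0 = mat 1"
| "matrix_power A (Suc n) = A ** matrix_power A n"

definition poly_matrix :: "real poly \<Rightarrow> real ^ 'n ^ 'n \<Rightarrow> real ^ 'n::finite ^ 'n" where
  "poly_matrix p A = (\<Sum>i\<le>degree p. coeff p i *\<^sub>R matrix_power A i)"

definition char_polynomial :: "real ^ 'n ^ 'n::finite \<Rightarrow> real poly" where
  "char_polynomial A = det (\<chi> i j. (if i = j then [:0, 1:] else 0) - [:A $ i $ j:])"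

definition eigenvalue :: "real ^ 'n ^ 'n::finite \<Rightarrow> real \<Rightarrow> bool" where
  "eigenvalue A x \<longleftrightarrow> (\<exists>v. v \<noteq> 0 \<and> A *v v = x *\<^sub>R v)"

text \<open>
  The distinct eigenvalues in decreasing order, with their algebraic multiplicities.
  For the symmetric matrices considered here all complex eigenvalues are real.
\<close>

definition graph_spectrum ::
    "('v::finite \<Rightarrow> 'v \<Rightarrow> bool) \<Rightarrow> nat \<Rightarrow> (nat \<Rightarrow> real) \<Rightarrow> (nat \<Rightarrow> nat) \<Rightarrow> bool" where
  "graph_spectrum E d \<theta> m \<longleftrightarrow>
     (\<forall>i j. i < j \<and> j \<le> d \<longrightarrow> \<theta> j < \<theta> i) \<and>
     \<theta> ` {..d} = {x. eigenvalue (adjacency_matrix E) x} \<and>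
     (\<forall>i\<le>d. m i = order (\<theta> i) (char_polynomial (adjacency_matrix E)))"

definition node_poly :: "(nat \<Rightarrow> real) \<Rightarrow> nat set \<Rightarrow> real \<Rightarrow> real poly" where
  "node_poly \<theta> I \<gamma> = smult \<gamma> (\<Prod>i\<in>I. [:- \<theta> i, 1:])"

definition shannon_admissible ::
    "nat \<Rightarrow> (nat \<Rightarrow> real) \<Rightarrow> (nat \<Rightarrow> nat) \<Rightarrow> nat \<Rightarrow> nat set \<Rightarrow> real \<Rightarrow> bool" where
  "shannon_admissible d \<theta> m k I \<gamma> \<longleftrightarrow>
     I \<subseteq> {..d} \<and> card I = k \<and>
     (\<Sum>i\<le>d. real (m i) * poly (node_poly \<theta> I \<gamma>) (\<theta> i)) = 1"

definition shannon_polynomial ::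
    "nat \<Rightarrow> (nat \<Rightarrow> real) \<Rightarrow> (nat \<Rightarrow> nat) \<Rightarrow> nat \<Rightarrow> real poly \<Rightarrow> bool" where
  "shannon_polynomial d \<theta> m k s \<longleftrightarrow>
     (\<exists>I \<gamma>. shannon_admissible d \<theta> m k I \<gamma> \<and> s = node_poly \<theta> I \<gamma> \<and>
        (\<forall>J \<delta>. shannon_admissible d \<theta> m k J \<delta> \<longrightarrow> (\<Sum>i\<in>J. m i) \<le> (\<Sum>i\<in>I. m i)))"

end

theory Submission
  imports Defs
begin

text \<open>
  The entries of the powers of the adjacency matrix \<open>A\<close> count walks. As \<open>s\<close> has degree at most
  \<open>k\<close>, the entries of \<open>s(A)\<close> at vertices of distance more than \<open>k\<close> vanish, and partial
  walk-regularity makes the diagonal of \<open>s(A)\<close> constant. Its trace \<open>\<Sum>\<^sub>i m\<^sub>i s(\<theta>\<^sub>i)\<close> equals 1, so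
  the diagonal has no zeros, and Haemers' bound applies to \<open>s(A)\<close>: the \<open>n\<close>-fold tensor power of
  \<open>s(A)\<close>, restricted to an independent set of the \<open>n\<close>-fold strong product, is an invertible
  diagonal matrix, while its rank is at most the \<open>n\<close>-th power of the rank of \<open>s(A)\<close>.
\<close>

section \<open>The spectral theorem for real symmetric matrices\<close>

lemma symmetric_inner_commute:
  fixes A :: "real ^ 'n ^ 'n"
  assumes "transpose A = A"
  shows "x \<bullet> (A *v y) = (A *v x) \<bullet> y"
  by (metis assms dot_lmul_matrix vector_transpose_matrix)

text \<open>A maximizer \<open>u\<close> of the quadratic form \<open>x \<bullet> (A *v x)\<close>
  on the unit sphere of \<open>S\<close> is an eigenvector: otherwise a small move along the
  residual \<open>A *v u - c *\<^sub>R u\<close> would push the Rayleigh quotient above its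
  maximum.\<close>

lemma symmetric_eigenvector_exists:
  fixes A :: "real ^ 'n ^ 'n"
  assumes sym: "transpose A = A" and S: "subspace S"
    and inv: "\<And>x. x \<in> S \<Longrightarrow> A *v x \<in> S" and nz: "\<exists>x\<in>S. x \<noteq> 0"
  obtains u c where "u \<in> S" "norm u = 1" "A *v u = c *\<^sub>R u"
proof -
  let ?K = "sphere 0 1 \<inter> S"
  let ?f = "\<lambda>x. x \<bullet> (A *v x)"
  obtain x0 where x0: "x0 \<in> S" "x0 \<noteq> 0" using nz by blast
  have "inverse (norm x0) *\<^sub>R x0 \<in> ?K"
    using x0 S by (simp add: subspace_scale)
  then have ne: "?K \<noteq> {}" by blast
  have "compact ?K" by (intro compact_Int_closed compact_sphere closed_subspace S)
  moreover have "continuous_on ?K ?f"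
    by (intro continuous_intros linear_continuous_on matrix_vector_mul_bounded_linear)
  ultimately obtain u where u: "u \<in> ?K" and max: "\<And>y. y \<in> ?K \<Longrightarrow> ?f y \<le> ?f u"
    using continuous_attains_sup[OF _ ne] by blast
  define c where "c = ?f u"
  define w where "w = A *v u - c *\<^sub>R u"
  have uu: "u \<bullet> u = 1" and uS: "u \<in> S" using u by (auto simp: norm_eq_1)
  \<comment> \<open>Maximality on the unit sphere extends to all of \<open>S\<close> by
    homogeneity.\<close>
  have bound: "?f x \<le> c * (x \<bullet> x)" if "x \<in> S" for x
  proof (cases "x = 0")
    case False
    let ?y = "inverse (norm x) *\<^sub>R x"
    have "?y \<in> ?K" using False that S by (simp add: subspace_scale)
    then have "?f ?y \<le> c" using max c_def by blast
    moreover have "?f ?y = ?f x / (x \<bullet> x)"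
      by (simp add: matrix_vector_mult_scaleR dot_square_norm power2_eq_square divide_inverse)
    ultimately have "?f x / (x \<bullet> x) \<le> c" by simp
    then show ?thesis using False by (simp add: pos_divide_le_eq)
  qed simp
  have wS: "w \<in> S" unfolding w_def by (intro subspace_diff subspace_scale S uS inv)
  have wu: "w \<bullet> u = 0"
    by (simp add: w_def inner_diff_left uu c_def inner_commute[of "A *v u"])
  have wAu: "w \<bullet> (A *v u) = w \<bullet> w"
  proof -
    have "A *v u = w + c *\<^sub>R u" by (simp add: w_def)
    then show ?thesis by (simp add: inner_add_right wu)
  qed
  define a where "a = w \<bullet> w"
  define b where "b = ?f w - c * a"
  \<comment> \<open>This is \<open>bound\<close> at \<open>u + t *\<^sub>R w\<close>: the terms
    constant in \<open>t\<close> cancel, and by symmetry of \<open>A\<close> both cross terms equal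
    \<open>a\<close>.\<close>
  have quad: "2 * t * a + t\<^sup>2 * b \<le> 0" for t
  proof -
    have "u + t *\<^sub>R w \<in> S" by (intro subspace_add subspace_scale S uS wS)
    from bound[OF this]
    have "?f u + t * (u \<bullet> (A *v w)) + t * (w \<bullet> (A *v u)) + t\<^sup>2 * ?f w
        \<le> c * (u \<bullet> u + 2 * t * (w \<bullet> u) + t\<^sup>2 * a)"
      by (simp add: matrix_vector_mult_scaleR matrix_vector_right_distrib inner_add_left
          inner_add_right a_def power2_eq_square algebra_simps inner_commute)
    moreover have "u \<bullet> (A *v w) = a"
      by (metis symmetric_inner_commute[OF sym] inner_commute wAu a_def)
    ultimately show ?thesis
      by (simp add: uu wu wAu a_def[symmetric] c_def[symmetric] b_def algebra_simps)
  qed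
  have "a = 0"
  proof (rule ccontr)
    assume "a \<noteq> 0"
    then have apos: "a > 0" by (simp add: a_def)
    \<comment> \<open>This step size gives \<open>\<bar>t * b\<bar> \<le> a\<close>, so the linear
      term outweighs the quadratic one; the \<open>+ 1\<close> keeps the denominator
      positive.\<close>
    define t where "t = a / (\<bar>b\<bar> + 1)"
    have tpos: "t > 0" using apos by (simp add: t_def add_nonneg_pos)
    have "t * \<bar>b\<bar> \<le> a" using apos by (simp add: t_def field_simps)
    then have "\<bar>t * b\<bar> \<le> a" using tpos by (simp add: abs_mult)
    then have "2 * a + t * b > 0" using apos by linarith
    moreover have "t * (2 * a + t * b) \<le> 0"
      using quad[of t] by (simp add: power2_eq_square algebra_simps)
    ultimately show False using tpos by (simp add: mult_le_0_iff)
  qed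
  then have "A *v u = c *\<^sub>R u" by (simp add: a_def w_def)
  then show thesis using that u by auto
qed

text \<open>Induction on the dimension: a unit eigenvector \<open>u\<close> is split off, and
  symmetry makes its orthogonal complement within \<open>S\<close> invariant again.\<close>

lemma symmetric_orthonormal_eigenbasis:
  fixes A :: "real ^ 'n ^ 'n"
  assumes sym: "transpose A = A" and "subspace S" and "\<And>x. x \<in> S \<Longrightarrow> A *v x \<in> S"
  shows "\<exists>B. pairwise orthogonal B \<and> (\<forall>b\<in>B. norm b = 1) \<and> span B = S
           \<and> (\<forall>b\<in>B. \<exists>c. A *v b = c *\<^sub>R b)"
  using assms(2-)
proof (induction "dim S" arbitrary: S rule: less_induct)
  case less
  show ?case
  proof (cases "\<exists>x\<in>S. x \<noteq> 0")
    case False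
    then have "S = {0}" using less.prems(1) subspace_0 by blast
    then show ?thesis by (intro exI[of _ "{}"]) (auto simp: pairwise_def)
  next
    case True
    obtain u c where u: "u \<in> S" "norm u = 1" "A *v u = c *\<^sub>R u"
      using symmetric_eigenvector_exists[OF sym less.prems True] by blast
    have uu: "u \<bullet> u = 1" using u by (simp add: norm_eq_1)
    define T where "T = S \<inter> {x. u \<bullet> x = 0}"
    have T: "subspace T"
      unfolding T_def by (intro subspace_inter less.prems subspace_hyperplane)
    have "u \<notin> T" by (simp add: T_def uu)
    then have "span T \<subset> span S"
      using T less.prems(1) u(1) T_def by (metis Int_lower1 psubsetI span_eq_iff)
    then have "dim T < dim S" by (rule dim_psubset)
    moreover have "A *v x \<in> T" if "x \<in> T" for x
      using that less.prems(2) u(3) symmetric_inner_commute[OF sym, of u x] by (simp add: T_def)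
    ultimately obtain B where B: "pairwise orthogonal B" "\<forall>b\<in>B. norm b = 1" "span B = T"
        "\<forall>b\<in>B. \<exists>c. A *v b = c *\<^sub>R b"
      using less.hyps[of T] T by blast
    have BT: "B \<subseteq> T" using B(3) span_superset by blast
    have "span (insert u B) = S"
    proof
      show "span (insert u B) \<subseteq> S"
        using BT u(1) less.prems(1) by (intro span_minimal) (auto simp: T_def)
      show "S \<subseteq> span (insert u B)"
      proof
        fix x assume "x \<in> S"
        then have "x - (u \<bullet> x) *\<^sub>R u \<in> T"
          using u(1) less.prems(1)
          by (simp add: T_def subspace_diff subspace_scale inner_diff_right uu)
        then show "x \<in> span (insert u B)" using B(3) span_breakdown_eq by blast
      qed
    qed
    moreover have "pairwise orthogonal (insert u B)"
      using B(1) BT by (auto simp: pairwise_insert T_def orthogonal_def inner_commute)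
    ultimately show ?thesis using u B by (intro exI[of _ "insert u B"]) auto
  qed
qed

text \<open>An eigenbasis of the whole space supplies the columns of \<open>P\<close>. The
  eigenvalues are listed by column, with repetitions, so multiplicities become counts of
  columns.\<close>

theorem symmetric_matrix_diagonalizable:
  fixes A :: "real ^ 'n ^ 'n"
  assumes "transpose A = A"
  obtains P :: "real ^ 'n ^ 'n" and \<nu>
  where "orthogonal_matrix P" "\<And>j. A *v column j P = \<nu> j *\<^sub>R column j P"
proof -
  obtain B where B: "pairwise orthogonal B" "\<forall>b\<in>B. norm b = 1" "span B = (UNIV :: (real^'n) set)"
      "\<forall>b\<in>B. \<exists>c. A *v b = c *\<^sub>R b"
    using symmetric_orthonormal_eigenbasis[OF assms, of UNIV] by auto
  have "0 \<notin> B" using B(2) by fastforce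
  then have "independent B" using B(1) pairwise_orthogonal_independent by blast
  then have fin: "finite B" and "card B = CARD('n)"
    using B(3) dim_eq_full[of B]
    by (auto simp: independent_imp_finite dim_eq_card_independent[symmetric])
  then obtain q :: "'n \<Rightarrow> real ^ 'n" where q: "bij_betw q UNIV B"
    using finite_same_card_bij[of "UNIV :: 'n set" B] by auto
  then have qB: "q j \<in> B" for j by (auto simp: bij_betw_def)
  define P :: "real ^ 'n ^ 'n" where "P = (\<chi> i j. q j $ i)"
  have col: "column j P = q j" for j by (simp add: P_def column_def vec_eq_iff)
  have "q i \<bullet> q j = (if i = j then 1 else 0)" for i j
    using B(1,2) qB[of i] qB[of j] q
    by (auto simp: bij_betw_def inj_eq pairwise_def orthogonal_def norm_eq_1)
  then have "transpose P ** P = mat 1"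
    by (simp add: matrix_matrix_mult_def transpose_def mat_def vec_eq_iff P_def inner_vec_def)
  then have P: "orthogonal_matrix P" by (simp add: orthogonal_matrix)
  have "\<forall>j. \<exists>c. A *v q j = c *\<^sub>R q j" using B(4) qB by blast
  from choice[OF this] obtain \<nu> where \<nu>: "\<forall>j. A *v q j = \<nu> j *\<^sub>R q j" ..
  have "A *v column j P = \<nu> j *\<^sub>R column j P" for j unfolding col using \<nu> ..
  with P show thesis by (rule that)
qed

section \<open>Invariants of a matrix with an orthonormal eigenbasis\<close>

text \<open>Column \<open>j\<close> of \<open>M ** P\<close> is a multiple of column
  \<open>j\<close> of \<open>P\<close>. Assuming only that the columns are eigenvectors of
  \<open>M\<close> lets one eigenbasis of \<open>A\<close> serve both for
  \<open>x *\<^sub>R mat 1 - A\<close> and for polynomials in \<open>A\<close>.\<close>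

lemma orthogonal_diagonalization:
  fixes M P :: "real ^ 'n ^ 'n"
  assumes P: "orthogonal_matrix P" and ev: "\<And>j. M *v column j P = \<mu> j *\<^sub>R column j P"
  shows "transpose P ** (M ** P) = (\<chi> i j. if i = j then \<mu> i else 0)"
proof -
  have "M ** P = P ** (\<chi> i j. if i = j then \<mu> i else 0)"
  proof -
    have "(M ** P) $ i $ j = (M *v column j P) $ i" for i j
      by (simp add: matrix_matrix_mult_def matrix_vector_mult_def column_def)
    then have "(M ** P) $ i $ j = \<mu> j * P $ i $ j" for i j
      by (simp add: ev) (simp add: column_def)
    then show ?thesis
      by (simp add: vec_eq_iff) (simp add: matrix_matrix_mult_def if_distrib[of "(*) _"] cong: if_cong)
  qed
  then show ?thesis
    using P by (simp add: matrix_mul_assoc orthogonal_matrix_def)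
qed

lemma trace_eq_sum_eigenvalues:
  fixes M P :: "real ^ 'n ^ 'n"
  assumes P: "orthogonal_matrix P" and ev: "\<And>j. M *v column j P = \<mu> j *\<^sub>R column j P"
  shows "trace M = (\<Sum>j\<in>UNIV. \<mu> j)"
proof -
  have "trace M = trace ((M ** P) ** transpose P)"
    using P by (simp add: matrix_mul_assoc[symmetric] orthogonal_matrix_def)
  also have "\<dots> = trace (transpose P ** (M ** P))" by (rule trace_mul_sym)
  also have "\<dots> = (\<Sum>j\<in>UNIV. \<mu> j)"
    by (simp add: orthogonal_diagonalization[OF assms] trace_def)
  finally show ?thesis .
qed

lemma det_eq_prod_eigenvalues:
  fixes M P :: "real ^ 'n ^ 'n"
  assumes P: "orthogonal_matrix P" and ev: "\<And>j. M *v column j P = \<mu> j *\<^sub>R column j P"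
  shows "det M = (\<Prod>j\<in>UNIV. \<mu> j)"
proof -
  have "det (transpose P) * det P = 1"
    using P by (metis det_I det_mul orthogonal_matrix_def)
  then have "det M = det (transpose P ** (M ** P))"
    by (simp add: det_mul algebra_simps)
  also have "\<dots> = (\<Prod>j\<in>UNIV. \<mu> j)"
    by (simp add: orthogonal_diagonalization[OF assms] det_diagonal)
  finally show ?thesis .
qed

text \<open>The range is spanned by the images \<open>\<mu> j *\<^sub>R column j P\<close>; those
  with \<open>\<mu> j = 0\<close> drop out and the others rescale to orthonormal columns.\<close>

lemma rank_eq_card_nonzero_eigenvalues:
  fixes M P :: "real ^ 'n ^ 'n"
  assumes P: "orthogonal_matrix P" and ev: "\<And>j. M *v column j P = \<mu> j *\<^sub>R column j P"
  shows "rank M = card {j. \<mu> j \<noteq> 0}"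
proof -
  let ?q = "\<lambda>j. column j P"
  let ?J = "{j. \<mu> j \<noteq> 0}"
  have norm1: "norm (?q j) = 1" for j
    using P by (simp add: orthogonal_matrix_orthonormal_columns)
  have orth: "orthogonal (?q i) (?q j)" if "i \<noteq> j" for i j
    using P that by (simp add: orthogonal_matrix_orthonormal_columns)
  have inj: "inj ?q"
  proof (rule injI, rule ccontr)
    fix i j assume "?q i = ?q j" "i \<noteq> j"
    then have "?q i = 0" using orth[of i j] by (simp add: orthogonal_self)
    then show False using norm1[of i] by simp
  qed
  have indep: "independent (?q ` J)" for J
  proof (rule pairwise_orthogonal_independent)
    show "pairwise orthogonal (?q ` J)" 
      unfolding pairwise_image by (intro pairwiseI impI orth) auto
    show "0 \<notin> ?q ` J" using norm1 by (metis imageE norm_zero zero_neq_one)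
  qed
  have "dim (range ?q) = DIM(real ^ 'n)"
    using indep[of UNIV] inj by (simp add: dim_eq_card_independent card_image)
  then have "span (range ?q) = UNIV" by (simp only: dim_eq_full)
  then have "range ((*v) M) = (*v) M ` span (range ?q)" by simp
  also have "\<dots> = span ((*v) M ` range ?q)"
    by (simp add: linear_span_image matrix_vector_mul_linear)
  also have "(*v) M ` range ?q = (\<lambda>j. \<mu> j *\<^sub>R ?q j) ` UNIV" by (simp add: image_image ev)
  also have "span \<dots> = span (?q ` ?J)"
  proof
    show "span ((\<lambda>j. \<mu> j *\<^sub>R ?q j) ` UNIV) \<subseteq> span (?q ` ?J)"
    proof (intro span_minimal image_subsetI subspace_span)
      fix j show "\<mu> j *\<^sub>R ?q j \<in> span (?q ` ?J)"
        by (cases "\<mu> j = 0") (auto intro: span_scale span_base simp: span_zero)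
    qed
    show "span (?q ` ?J) \<subseteq> span ((\<lambda>j. \<mu> j *\<^sub>R ?q j) ` UNIV)"
    proof (intro span_minimal image_subsetI subspace_span)
      fix j assume "j \<in> ?J"
      then have "?q j = inverse (\<mu> j) *\<^sub>R (\<mu> j *\<^sub>R ?q j)" by simp
      also have "\<dots> \<in> span ((\<lambda>j. \<mu> j *\<^sub>R ?q j) ` UNIV)" by (intro span_scale span_base) simp
      finally show "?q j \<in> span ((\<lambda>j. \<mu> j *\<^sub>R ?q j) ` UNIV)" .
    qed
  qed
  finally have "rank M = dim (?q ` ?J)" by (simp add: rank_dim_range)
  also have "\<dots> = card ?J"
    using indep inj by (metis dim_eq_card_independent card_image inj_on_subset subset_UNIV)
  finally show ?thesis .
qed

section \<open>Polynomials in a matrix and the characteristic polynomial\<close>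

lemma matrix_power_eigenvector:
  assumes "A *v x = c *\<^sub>R x"
  shows "matrix_power A n *v x = c ^ n *\<^sub>R x"
  by (induction n) (simp_all add: assms matrix_vector_mul_assoc[symmetric] matrix_vector_mult_scaleR)

lemma sum_matrix_vector_mult:
  fixes f :: "'i \<Rightarrow> real ^ 'n ^ 'm"
  shows "(\<Sum>i\<in>I. f i) *v x = (\<Sum>i\<in>I. f i *v x)"
  by (induction I rule: infinite_finite_induct) (simp_all add: matrix_vector_mult_add_rdistrib)

lemma poly_matrix_eigenvector:
  assumes "A *v x = c *\<^sub>R x"
  shows "poly_matrix p A *v x = poly p c *\<^sub>R x"
  by (simp add: poly_matrix_def sum_matrix_vector_mult scaleR_matrix_vector_assoc[symmetric]
      matrix_power_eigenvector[OF assms] poly_altdef scaleR_sum_left)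

lemma poly_det: "poly (det M) x = det (\<chi> i j. poly (M $ i $ j) x)"
  by (simp add: det_def poly_sum poly_prod)

text \<open>Both sides are compared as functions on the reals: at each \<open>x\<close> the left one
  is the determinant of \<open>x *\<^sub>R mat 1 - A\<close>, whose eigenvalues on the columns of
  \<open>P\<close> are \<open>x - \<nu> j\<close>.\<close>

lemma char_polynomial_eq_prod:
  fixes A P :: "real ^ 'n ^ 'n"
  assumes P: "orthogonal_matrix P" and ev: "\<And>j. A *v column j P = \<nu> j *\<^sub>R column j P"
  shows "char_polynomial A = (\<Prod>j\<in>UNIV. [:- \<nu> j, 1:])"
proof -
  have "poly (char_polynomial A) x = poly (\<Prod>j\<in>UNIV. [:- \<nu> j, 1:]) x" for x
  proof -
    have "poly (char_polynomial A) x = det (x *\<^sub>R mat 1 - A)"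
      unfolding char_polynomial_def poly_det
      by (rule arg_cong[where f = det]) (simp add: vec_eq_iff mat_def)
    also have "\<dots> = (\<Prod>j\<in>UNIV. x - \<nu> j)"
      by (rule det_eq_prod_eigenvalues[OF P])
        (simp add: matrix_vector_mult_diff_rdistrib scaleR_matrix_vector_assoc[symmetric] ev
          scaleR_left_diff_distrib)
    finally show ?thesis by (simp add: poly_prod)
  qed
  then show ?thesis by (simp add: poly_eq_poly_eq_iff[symmetric] fun_eq_iff)
qed

text \<open>Orders add over a product, and each linear factor contributes 1 or 0. With
  \<open>char_polynomial_eq_prod\<close> this turns algebraic multiplicities into counts of
  columns.\<close>

lemma order_prod_linear:
  fixes \<nu> :: "'i \<Rightarrow> 'a::idom"
  assumes "finite I"
  shows "order x (\<Prod>i\<in>I. [:- \<nu> i, 1:]) = card {i\<in>I. \<nu> i = x}"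
  using assms
proof (induction I)
  case (insert i I)
  have "order x [:- \<nu> i, 1:] = (if \<nu> i = x then 1 else 0)"
    using order_power_n_n[of x 1] by (auto intro: order_0I)
  \<comment> \<open>Additivity of \<open>order\<close> is available for a nonzero product.\<close>
  moreover have "[:- \<nu> i, 1:] * (\<Prod>i\<in>I. [:- \<nu> i, 1:]) \<noteq> 0"
    using insert.hyps by (simp del: mult_pCons_left)
  moreover have "{j \<in> insert i I. \<nu> j = x} = (if \<nu> i = x then insert i {j\<in>I. \<nu> j = x} else {j\<in>I. \<nu> j = x})"
    by auto
  ultimately show ?case
    using insert by (simp add: order_mult del: mult_pCons_left)
qed simp

section \<open>Walks\<close>

lemma walks_0: "walks E u 0 v = (if u = v then {[u]} else {})"
  by (auto simp: walks_def length_Suc_conv)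

text \<open>Sorting walks by their second vertex \<open>w\<close> mirrors the recursion of
  \<open>matrix_power\<close>.\<close>

lemma walks_Suc: "walks E u (Suc l) v = (\<Union>w\<in>{w. E u w}. (#) u ` walks E w l v)"
proof (intro set_eqI iffI)
  fix p assume p: "p \<in> walks E u (Suc l) v"
  then obtain w r where "p = u # w # r"
    by (auto simp: walks_def length_Suc_conv)
  then show "p \<in> (\<Union>w\<in>{w. E u w}. (#) u ` walks E w l v)"
    using p by (auto simp: walks_def)
qed (auto simp: walks_def length_Suc_conv)

lemma finite_walks: "finite (walks (E :: 'v::finite \<Rightarrow> 'v \<Rightarrow> bool) u l v)"
  by (induction l arbitrary: u) (auto simp: walks_0 walks_Suc)

lemma matrix_power_adjacency:
  "matrix_power (adjacency_matrix E) l $ u $ v = real (card (walks E u l v))"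
proof (induction l arbitrary: u)
  case (Suc l)
  \<comment> \<open>The pieces are disjoint because \<open>w\<close> can be read off as the second
    vertex of the walk.\<close>
  have "card (walks E u (Suc l) v) = (\<Sum>w | E u w. card ((#) u ` walks E w l v))"
    unfolding walks_Suc
    by (rule card_UN_disjoint) (auto simp: finite_walks, auto simp: walks_def)
  also have "\<dots> = (\<Sum>w | E u w. card (walks E w l v))" by (simp add: card_image)
  finally show ?case
    by (simp add: matrix_matrix_mult_def Suc.IH)
      (simp add: adjacency_matrix_def if_distrib[of "\<lambda>x. x * _"] sum.If_cases cong: if_cong)
qed (simp add: walks_0 mat_def)

lemma poly_matrix_adjacency:
  "poly_matrix p (adjacency_matrix E) $ u $ v
     = (\<Sum>l\<le>degree p. coeff p l * real (card (walks E u l v)))"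
  by (simp add: poly_matrix_def matrix_power_adjacency)

text \<open>All lengths up to \<open>degree p\<close> lie below the least length of a walk from
  \<open>u\<close> to \<open>v\<close>, so every walk count in the entry is zero.\<close>

lemma poly_matrix_adjacency_eq_0:
  assumes "degree p < graph_dist E u v"
  shows "poly_matrix p (adjacency_matrix E) $ u $ v = 0"
proof -
  have "walks E u l v = {}" if "l \<le> degree p" for l
    using not_less_Least[of l "\<lambda>l. walks E u l v \<noteq> {}"] that assms
    unfolding graph_dist_def by auto
  then show ?thesis by (simp add: poly_matrix_adjacency)
qed

text \<open>A diagonal entry combines counts of closed walks of length at most
  \<open>k\<close>.\<close>

lemma poly_matrix_adjacency_diagonal_const:
  assumes "partially_walk_regular k E" "degree p \<le> k"
  shows "poly_matrix p (adjacency_matrix E) $ u $ u = poly_matrix p (adjacency_matrix E) $ v $ v"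
  unfolding poly_matrix_adjacency
  using assms by (intro sum.cong refl) (auto simp: partially_walk_regular_def)

section \<open>Haemers' bound\<close>

text \<open>Gaussian elimination, one equation at a time. Finite index sets replace matrix types
  because the indices will be lists and functions, drawn from infinite types.\<close>

lemma homogeneous_system_nontrivial_solution:
  fixes Q :: "'j \<Rightarrow> 'i \<Rightarrow> 'a::field"
  assumes "finite J" "finite S" "card J < card S"
  shows "\<exists>c. (\<exists>y\<in>S. c y \<noteq> 0) \<and> (\<forall>j\<in>J. (\<Sum>y\<in>S. Q j y * c y) = 0)"
  using assms
proof (induction J arbitrary: S Q rule: finite_induct)
  case empty
  then have "S \<noteq> {}" by auto
  then show ?case by (intro exI[of _ "\<lambda>_. 1"]) auto
next
  case (insert j J)
  show ?case
  proof (cases "\<forall>y\<in>S. Q j y = 0")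
    case True
    have "card J < card S" using insert by simp
    then obtain c where "\<exists>y\<in>S. c y \<noteq> 0" "\<forall>i\<in>J. (\<Sum>y\<in>S. Q i y * c y) = 0"
      using insert.IH[of S Q] insert.prems by blast
    then show ?thesis using True by (intro exI[of _ c]) auto
  next
    case False
    then obtain z where z: "z \<in> S" "Q j z \<noteq> 0" by blast
    let ?S = "S - {z}"
    have "card J < card ?S" using insert z by simp
    \<comment> \<open>Equation \<open>j\<close> is solved for the unknown \<open>z\<close> and
      substituted into the others, leaving one equation and one unknown fewer.\<close>
    then obtain c where c: "\<exists>y\<in>?S. c y \<noteq> 0"
        "\<forall>i\<in>J. (\<Sum>y\<in>?S. (Q i y - Q j y / Q j z * Q i z) * c y) = 0"
      using insert.IH[of ?S "\<lambda>i y. Q i y - Q j y / Q j z * Q i z"] insert.prems by blast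
    define r where "r = (\<Sum>y\<in>?S. Q j y * c y)"
    \<comment> \<open>The value at \<open>z\<close> is the one that equation \<open>j\<close>
      forces.\<close>
    define e where "e = c(z := - r / Q j z)"
    have e: "(\<Sum>y\<in>S. Q i y * e y) = (\<Sum>y\<in>?S. Q i y * c y) - Q i z * r / Q j z" for i
    proof -
      have "(\<Sum>y\<in>S. Q i y * e y) = Q i z * e z + (\<Sum>y\<in>?S. Q i y * e y)"
        using z insert.prems by (simp add: sum.remove)
      also have "(\<Sum>y\<in>?S. Q i y * e y) = (\<Sum>y\<in>?S. Q i y * c y)"
        by (intro sum.cong) (auto simp: e_def)
      finally show ?thesis by (simp add: e_def)
    qed
    have "(\<Sum>y\<in>S. Q j y * e y) = 0" using z by (simp add: e r_def)
    moreover have "(\<Sum>y\<in>S. Q i y * e y) = 0" if "i \<in> J" for i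
    proof -
      have "0 = (\<Sum>y\<in>?S. Q i y * c y - Q i z / Q j z * (Q j y * c y))"
        using c(2) that by (simp add: algebra_simps)
      also have "\<dots> = (\<Sum>y\<in>?S. Q i y * c y) - Q i z / Q j z * r"
        by (simp add: sum_subtractf sum_distrib_left r_def)
      finally show ?thesis by (simp add: e)
    qed
    moreover have "\<exists>y\<in>S. e y \<noteq> 0" using c(1) by (auto simp: e_def)
    ultimately show ?thesis by (intro exI[of _ e]) auto
  qed
qed

text \<open>An invertible diagonal matrix on \<open>S\<close> cannot factor through fewer than
  \<open>card S\<close> dimensions: a nonzero \<open>c\<close> killed by \<open>Q\<close> would be
  killed by the product, whose row \<open>z\<close> sends \<open>c\<close> to a nonzero multiple of
  \<open>c z\<close>.\<close>

lemma card_le_of_diagonal_factorization: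
  fixes R :: "'i \<Rightarrow> 'j \<Rightarrow> 'a::field"
  assumes "finite J" "finite S"
    and diag: "\<And>x. x \<in> S \<Longrightarrow> (\<Sum>j\<in>J. R x j * Q j x) \<noteq> 0"
    and off: "\<And>x y. x \<in> S \<Longrightarrow> y \<in> S \<Longrightarrow> x \<noteq> y \<Longrightarrow> (\<Sum>j\<in>J. R x j * Q j y) = 0"
  shows "card S \<le> card J"
proof (rule ccontr)
  assume "\<not> card S \<le> card J"
  then obtain c z where z: "z \<in> S" "c z \<noteq> 0" and c: "\<forall>j\<in>J. (\<Sum>y\<in>S. Q j y * c y) = 0"
    using homogeneous_system_nontrivial_solution[OF assms(1,2), of Q] by auto
  have "0 = (\<Sum>j\<in>J. R z j * (\<Sum>y\<in>S. Q j y * c y))" using c by simp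
  also have "\<dots> = (\<Sum>y\<in>S. (\<Sum>j\<in>J. R z j * Q j y) * c y)"
    unfolding sum_distrib_left sum_distrib_right mult.assoc by (rule sum.swap)
  also have "\<dots> = (\<Sum>y\<in>S. if y = z then (\<Sum>j\<in>J. R z j * Q j z) * c z else 0)"
    by (intro sum.cong) (auto simp: off z)
  also have "\<dots> = (\<Sum>j\<in>J. R z j * Q j z) * c z" using z assms(2) by simp
  finally show False using z diag by simp
qed

text \<open>\<open>B\<close> is a basis of the row space chosen among the rows, and
  \<open>R u\<close> holds the coordinates of row \<open>u\<close>.\<close>

lemma rank_factorization:
  fixes M :: "real ^ 'n ^ 'm"
  obtains B :: "(real ^ 'n) set" and R where "finite B" "card B = rank M"
    "\<And>u v. M $ u $ v = (\<Sum>b\<in>B. R u b * b $ v)"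
proof -
  obtain B where B: "B \<subseteq> rows M" "independent B" "rows M \<subseteq> span B" "card B = dim (rows M)"
    by (rule basis_exists)
  have fin: "finite B" using B(2) by (rule independent_imp_finite)
  have "\<exists>r. row u M = (\<Sum>b\<in>B. r b *\<^sub>R b)" for u
    using B(3) span_finite[OF fin] by (auto simp: rows_def)
  then obtain R where R: "\<And>u. row u M = (\<Sum>b\<in>B. R u b *\<^sub>R b)" by metis
  have "M $ u $ v = (\<Sum>b\<in>B. R u b * b $ v)" for u v
    using arg_cong[OF R, of "\<lambda>x. x $ v" u] by (simp add: row_def)
  then show thesis using that fin B(4) by (simp add: row_rank_def)
qed

text \<open>The tensor power appears only through its entries, which are products of entries of
  \<open>M\<close>. Expanding each factor by the rank factorization gives a sum over the functions
  from positions to \<open>B\<close>, of which there are \<open>rank M ^ n\<close>.\<close>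

lemma independent_set_strong_power_le_rank:
  fixes M :: "real ^ 'v ^ 'v"
  assumes diag: "\<And>v. M $ v $ v \<noteq> 0"
    and off: "\<And>u v. u \<noteq> v \<Longrightarrow> \<not> H u v \<Longrightarrow> M $ u $ v = 0"
    and S: "independent_set (strong_power_verts UNIV n) (strong_power_adj H n) S"
  shows "card S \<le> rank M ^ n"
proof -
  obtain B :: "(real ^ 'v) set" and R where B: "finite B" "card B = rank M"
    and M: "\<And>u v. M $ u $ v = (\<Sum>b\<in>B. R u b * b $ v)"
    using rank_factorization[of M] by metis
  have len: "length x = n" if "x \<in> S" for x
    using S that by (auto simp: independent_set_def strong_power_verts_def)
  have "S \<subseteq> {xs. set xs \<subseteq> UNIV \<and> length xs = n}" using len by auto
  then have finS: "finite S" by (rule finite_subset) (rule finite_lists_length_eq, simp)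
  let ?J = "{..<n} \<rightarrow>\<^sub>E B"
  have tensor: "(\<Sum>g\<in>?J. (\<Prod>i<n. R (x ! i) (g i)) * (\<Prod>i<n. g i $ (y ! i)))
      = (\<Prod>i<n. M $ (x ! i) $ (y ! i))" for x y
    using B by (simp add: M prod_sum_PiE prod.distrib)
  have "card S \<le> card ?J"
  proof (rule card_le_of_diagonal_factorization)
    show "finite ?J" using B by (simp add: finite_PiE)
    fix x assume x: "x \<in> S"
    show "(\<Sum>g\<in>?J. (\<Prod>i<n. R (x ! i) (g i)) * (\<Prod>i<n. g i $ (x ! i))) \<noteq> 0"
      unfolding tensor using diag by simp
    fix y assume y: "y \<in> S" and "x \<noteq> y"
    then have "\<not> strong_power_adj H n x y"
      using S x by (auto simp: independent_set_def)
    \<comment> \<open>Distinct nonadjacent tuples differ in some coordinate whose entries are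
      nonadjacent; it contributes a zero factor.\<close>
    then obtain i where "i < n" "x ! i \<noteq> y ! i" "\<not> H (x ! i) (y ! i)"
      using \<open>x \<noteq> y\<close> by (auto simp: strong_power_adj_def)
    then show "(\<Sum>g\<in>?J. (\<Prod>i<n. R (x ! i) (g i)) * (\<Prod>i<n. g i $ (y ! i))) = 0"
      unfolding tensor using off by (intro prod_zero) auto
  qed (fact finS)
  also have "card ?J = rank M ^ n" using B by (simp add: card_PiE)
  finally show ?thesis .
qed

text \<open>For every positive \<open>n\<close> the \<open>n\<close>-th root of
  \<open>rank M ^ n\<close> is \<open>rank M\<close>, so one bound covers the whole
  supremum.\<close>

theorem shannon_capacity_le_rank:
  fixes M :: "real ^ 'v ^ 'v"
  assumes diag: "\<And>v. M $ v $ v \<noteq> 0"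
    and off: "\<And>u v. u \<noteq> v \<Longrightarrow> \<not> H u v \<Longrightarrow> M $ u $ v = 0"
  shows "shannon_capacity UNIV H \<le> real (rank M)"
  unfolding shannon_capacity_def
proof (rule cSUP_least)
  fix n :: nat assume n: "n \<in> {1..}"
  let ?V = "strong_power_verts (UNIV :: 'v set) n" and ?H = "strong_power_adj H n"
  let ?C = "{card S | S. independent_set ?V ?H S}"
  have le: "c \<le> rank M ^ n" if "c \<in> ?C" for c
    using that independent_set_strong_power_le_rank[OF assms] by blast
  then have "finite ?C" by (intro finite_subset[of ?C "{..rank M ^ n}"]) auto
  moreover have "independent_set ?V ?H {}" by (simp add: independent_set_def)
  then have "?C \<noteq> {}" by blast
  ultimately have "independence_number ?V ?H \<le> rank M ^ n"
    unfolding independence_number_def using le by simp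
  then have "real (independence_number ?V ?H) \<le> real (rank M) ^ n"
    by (simp only: of_nat_power[symmetric] of_nat_le_iff)
  then have "root n (real (independence_number ?V ?H)) \<le> root n (real (rank M) ^ n)"
    using n by simp
  also have "\<dots> = real (rank M)" using n by (simp add: real_root_power_cancel)
  finally show "root n (real (independence_number ?V ?H)) \<le> real (rank M)" .
qed simp

section \<open>Shannon polynomials\<close>

lemma degree_node_poly_le: "degree (node_poly \<theta> I \<gamma>) \<le> card I"
proof (cases "finite I")
  case True
  have "degree (\<Prod>i\<in>I. [:- \<theta> i, 1:]) \<le> card I"
    using degree_prod_sum_le[OF True, of "\<lambda>i. [:- \<theta> i, 1:]"] by simp
  then show ?thesis
    unfolding node_poly_def by (rule order_trans[OF degree_smult_le])
\<comment> \<open>For infinite \<open>I\<close> the product defaults to 1 and \<open>card I\<close>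
  to 0, so the polynomial is constant.\<close>
qed (simp add: node_poly_def)

text \<open>Columns of \<open>P\<close> are grouped by eigenvalue, and \<open>m i\<close> is the
  size of a group. A general semiring covers both uses: the real trace and the natural-number
  rank.\<close>

lemma graph_spectrum_sum:
  fixes f :: "real \<Rightarrow> 'b::comm_semiring_1"
  assumes spec: "graph_spectrum E d \<theta> m" and P: "orthogonal_matrix P"
    and ev: "\<And>j. adjacency_matrix E *v column j P = \<nu> j *\<^sub>R column j P"
  shows "(\<Sum>i\<le>d. of_nat (m i) * f (\<theta> i)) = (\<Sum>j\<in>UNIV. f (\<nu> j))"
proof -
  have inj: "inj_on \<theta> {..d}"
    using spec unfolding graph_spectrum_def inj_on_def
    by (metis atMost_iff less_irrefl linorder_neqE_nat)
  have m: "m i = card {j. \<nu> j = \<theta> i}" if "i \<le> d" for i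
    using that spec order_prod_linear[of "UNIV" "\<theta> i" \<nu>]
    by (simp add: graph_spectrum_def char_polynomial_eq_prod[OF P ev])
  \<comment> \<open>Nonzero columns make every \<open>\<nu> j\<close> an eigenvalue, so the grouping
    misses no column.\<close>
  have "column j P \<noteq> 0" for j
    using P by (metis norm_zero orthogonal_matrix_orthonormal_columns zero_neq_one)
  then have "range \<nu> \<subseteq> {x. eigenvalue (adjacency_matrix E) x}"
    using ev by (auto simp: eigenvalue_def)
  then have sub: "range \<nu> \<subseteq> \<theta> ` {..d}" using spec by (simp add: graph_spectrum_def)
  have "(\<Sum>i\<le>d. of_nat (m i) * f (\<theta> i)) = (\<Sum>i\<le>d. \<Sum>j | \<nu> j = \<theta> i. f (\<nu> j))"
    by (intro sum.cong) (auto simp: m)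
  also have "\<dots> = (\<Sum>x\<in>\<theta> ` {..d}. \<Sum>j | \<nu> j = x. f (\<nu> j))"
    using inj by (simp add: sum.reindex)
  also have "\<dots> = (\<Sum>j\<in>UNIV. f (\<nu> j))"
    using sum.group[of UNIV "\<theta> ` {..d}" \<nu> "\<lambda>j. f (\<nu> j)"] sub by simp
  finally show ?thesis .
qed

theorem theorem4p3:
  fixes E :: "'v::finite \<Rightarrow> 'v \<Rightarrow> bool"
    and d k :: nat
    and \<theta> :: "nat \<Rightarrow> real"
    and m :: "nat \<Rightarrow> nat"
    and s :: "real poly"
  assumes "simple_graph E"
    and "graph_connected E"
    and "partially_walk_regular k E"
    and "graph_spectrum E d \<theta> m"
    and "k < graph_diameter E"
    and "shannon_polynomial d \<theta> m k s"
  shows "shannon_capacity UNIV (graph_power E k)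
           \<le> real (rank (poly_matrix s (adjacency_matrix E)))
       \<and> rank (poly_matrix s (adjacency_matrix E))
           = (\<Sum>i\<in>{i. i \<le> d \<and> poly s (\<theta> i) \<noteq> 0}. m i)"
proof
  let ?A = "adjacency_matrix E"
  let ?M = "poly_matrix s ?A"
  have deg: "degree s \<le> k" and one: "(\<Sum>i\<le>d. real (m i) * poly s (\<theta> i)) = 1"
    using assms(6) degree_node_poly_le
    by (auto simp: shannon_polynomial_def shannon_admissible_def)
  have "transpose ?A = ?A"
    using assms(1)
    by (auto simp: simple_graph_def symp_def transpose_def adjacency_matrix_def vec_eq_iff)
  then obtain P \<nu> where P: "orthogonal_matrix P"
    and ev: "\<And>j. ?A *v column j P = \<nu> j *\<^sub>R column j P"
    using symmetric_matrix_diagonalizable by blast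
  \<comment> \<open>The same orthonormal basis diagonalizes \<open>?M\<close>, with eigenvalues
    \<open>poly s (\<nu> j)\<close>.\<close>
  note evM = poly_matrix_eigenvector[OF ev, of s]
  note spectrum_sum = graph_spectrum_sum[OF assms(4) P ev]

  have trace: "trace ?M = 1"
    using trace_eq_sum_eigenvalues[OF P evM] spectrum_sum[of "poly s"] one by simp
  have diag: "?M $ v $ v \<noteq> 0" for v
  proof
    assume "?M $ v $ v = 0"
    then have "?M $ u $ u = 0" for u
      using poly_matrix_adjacency_diagonal_const[OF assms(3) deg] by metis
    then show False using trace by (simp add: trace_def)
  qed
  show "shannon_capacity UNIV (graph_power E k) \<le> real (rank ?M)"
  proof (rule shannon_capacity_le_rank[OF diag])
    \<comment> \<open>Such vertices lie at distance greater than \<open>k\<close>, hence greater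
      than the degree of \<open>s\<close>.\<close>
    fix u v assume "u \<noteq> v" "\<not> graph_power E k u v"
    then show "?M $ u $ v = 0"
      using deg by (intro poly_matrix_adjacency_eq_0) (simp add: graph_power_def)
  qed

  \<comment> \<open>The number of columns is written as a sum of indicators so that
    \<open>spectrum_sum\<close> can regroup it by distinct eigenvalues.\<close>
  have "rank ?M = (\<Sum>j\<in>UNIV. if poly s (\<nu> j) \<noteq> 0 then 1 else 0)"
    by (simp add: rank_eq_card_nonzero_eigenvalues[OF P evM] sum.If_cases)
  also have "\<dots> = (\<Sum>i\<le>d. m i * (if poly s (\<theta> i) \<noteq> 0 then 1 else 0))"
    using spectrum_sum[of "\<lambda>x. if poly s x \<noteq> 0 then 1 else (0::nat)"] by simp
  also have "\<dots> = (\<Sum>i\<in>{i. i \<le> d \<and> poly s (\<theta> i) \<noteq> 0}. m i)"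
    by (rule sum.mono_neutral_cong_right) auto
  finally show "rank ?M = (\<Sum>i\<in>{i. i \<le> d \<and> poly s (\<theta> i) \<noteq> 0}. m i)" .
qed

end
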